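(* Let $l_x,l_y,l_z,u_z$ be real numbers with $0<l_z<u_z<1$, $l_z\le l_x\le u_z$, $l_z\le l_y\le u_z$ and $l_xl_y<l_z$. Suppose that $(l_x,l_y)$ is in region B, i.e. $l_z\le l_x\le\sqrt{l_zu_z}$ and $l_z\le l_y\le\sqrt{l_zu_z}$. Let $\mathcal F'=\{(x,y,z)\in\mathbb R^3 : z=xy,\ l_x\le x\le 1,\ l_y\le y\le 1,\ l_z\le z\le u_z\}$ and let $$M_1=\begin{pmatrix}u_z^2 & 2l_z-u_z\\ 2l_z-u_z & 1\end{pmatrix},\qquad M_2=\begin{pmatrix}1 & 2l_z-u_z\\ 2l_z-u_z & u_z^2\end{pmatrix}$$ (both positive semidefinite). Then $\operatorname{conv}(\mathcal F')$ is exactly the set of $(x,y,z)\in\mathbb R^3$ satisfying the RLT constraints $$z\ge x+y-1,\qquad z\ge l_yx+l_xy-l_xl_y,\qquad z\le x+l_xy-l_x,\qquad z\le l_yx+y-l_y,$$ the bounds $l_z\le z\le u_z$, and the following three second-order cone constraints, each imposed only when $(x,y)$ is in the indicated region: 1. if $y\ge u_zx$ and $x\ge u_zy$, then $(z+\sqrt{l_zu_z})^2\le(\sqrt{l_z}+\sqrt{u_z})^2\,xy$; 2. if $y\le u_zx$, then $\sqrt{(\hat x,\hat y)M_1(\hat x,\hat y)^T}\le u_zx+y-2z$, where $\hat x:=1-x$, $\hat y:=u_z-y$; 3. if $x\le u_zy$, then $\sqrt{(\hat x,\hat y)M_2(\hat x,\hat y)^T}\le x+u_zy-2z$, where $\hat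 x:=u_z-x$, $\hat y:=1-y$.
   Context: $\operatorname{conv}$ denotes the convex hull in $\mathbb R^3$. "RLT" stands for Reformulation-Linearization Technique; the RLT constraints are written out in the claim for the box $l_x\le x\le 1$, $l_y\le y\le 1$. *)

theory Defs
  imports "HOL-Analysis.Analysis"
begin

definition F' :: "real \<Rightarrow> real \<Rightarrow> real \<Rightarrow> real \<Rightarrow> (real \<times> real \<times> real) set" where
  "F' lx ly lz uz =
     {(x, y, z). z = x * y \<and> lx \<le> x \<and> x \<le> 1 \<and> ly \<le> y \<and> y \<le> 1 \<and> lz \<le> z \<and> z \<le> uz}"

definition region_B :: "real \<Rightarrow> real \<Rightarrow> (real \<times> real) set" where
  "region_B lz uz = {(a, b). lz \<le> a \<and> a \<le> sqrt (lz * uz) \<and> lz \<le> b \<and> b \<le> sqrt (lz * uz)}"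

definition M1 :: "real \<Rightarrow> real \<Rightarrow> real^2^2" where
  "M1 lz uz = vector [vector [uz\<^sup>2, 2 * lz - uz], vector [2 * lz - uz, 1]]"

definition M2 :: "real \<Rightarrow> real \<Rightarrow> real^2^2" where
  "M2 lz uz = vector [vector [1, 2 * lz - uz], vector [2 * lz - uz, uz\<^sup>2]]"

definition quad_form :: "real^'n^'n \<Rightarrow> real^'n \<Rightarrow> real" where
  "quad_form M v = v \<bullet> (M *v v)"

definition psd :: "real^'n^'n \<Rightarrow> bool" where
  "psd M \<longleftrightarrow> transpose M = M \<and> (\<forall>v. 0 \<le> quad_form M v)"

text \<open>The reformulation-linearization (McCormick) inequalities for the product \<open>z = x y\<close>
  over the box \<open>lx \<le> x \<le> 1\<close>, \<open>ly \<le> y \<le> 1\<close>.\<close>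

definition RLT :: "real \<Rightarrow> real \<Rightarrow> real \<Rightarrow> real \<Rightarrow> real \<Rightarrow> bool" where
  "RLT lx ly x y z \<longleftrightarrow>
     z \<ge> x + y - 1 \<and>
     z \<ge> ly * x + lx * y - lx * ly \<and>
     z \<le> x + lx * y - lx \<and>
     z \<le> ly * x + y - ly"

end

theory Submission
  imports Defs
begin

text \<open>
  The three conic constraints are cones over the arc \<open>x y = lz\<close> in the plane \<open>z = lz\<close>. The first has
  apex \<open>W = (0, 0, - sqrt (lz * uz))\<close> and also meets the plane \<open>z = uz\<close> in the arc \<open>x y = uz\<close>;
  the others have apexes \<open>(1, uz, uz)\<close> and \<open>(uz, 1, uz)\<close>. The regions are unions of
  rays through the respective apex. A point satisfying all constraints is therefore moved along its ray
  until it meets a plane \<open>z = lz\<close>, \<open>z = uz\<close> or an RLT plane; there it lies in a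
  hyperbolic segment or in a trapezoid spanned by points of \<open>F'\<close>. Conversely, each constraint
  is, in its region, implied by the affine inequalities of its tangent planes, and those tangent
  planes that are active in the region are valid on all of \<open>F'\<close>.
\<close>

section \<open>Convexity tools: segments, half-spaces and planar pieces of a convex set\<close>

lemma convex_triple:
  fixes H :: "(real \<times> real \<times> real) set"
  assumes "convex H" "(x1, y1, z1) \<in> H" "(x2, y2, z2) \<in> H" "0 \<le> t" "t \<le> 1"
    and "x = t * x1 + (1 - t) * x2" "y = t * y1 + (1 - t) * y2" "z = t * z1 + (1 - t) * z2"
  shows "(x, y, z) \<in> H"
proof -
  have "t *\<^sub>R (x1, y1, z1) + (1 - t) *\<^sub>R (x2, y2, z2) \<in> H"
    by (rule convexD) (use assms in auto)
  then show ?thesis using assms(6-8) by simp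
qed

lemma linear_swap12: "linear (\<lambda>(x, y, z). (y, x, z) :: real \<times> real \<times> real)"
  by (rule linearI) auto

text \<open>Every necessary condition is obtained this way: half-spaces are convex, so an affine
  inequality has to be checked on the generating set only. The conic constraints are reached through
  families of such inequalities.\<close>

lemma affine_ineq_hull:
  fixes a b c d :: real
  assumes "\<And>x y z. (x, y, z) \<in> S \<Longrightarrow> d \<le> a * x + b * y + c * z"
    and "(x, y, z) \<in> convex hull S"
  shows "d \<le> a * x + b * y + c * z"
proof -
  have eq: "{(x, y, z). d \<le> a * x + b * y + c * z} = {p. inner (a, b, c) p \<ge> d}"
    by auto
  have "convex hull S \<subseteq> {(x, y, z). d \<le> a * x + b * y + c * z}"
  proof (rule hull_minimal)
    show "S \<subseteq> {(x, y, z). d \<le> a * x + b * y + c * z}" using assms(1) by auto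
    show "convex {(x, y, z). d \<le> a * x + b * y + c * z}"
      unfolding eq by (rule convex_halfspace_ge)
  qed
  then show ?thesis using assms(2) by auto
qed

text \<open>Eliminating \<open>y\<close> between \<open>c \<le> x * y\<close> and the chord
  inequality traps \<open>x\<close> between \<open>a\<close> and \<open>b\<close>. The point then
  lies on a segment parallel to the \<open>y\<close>-axis that joins the arc to its chord.\<close>

lemma hyperbola_segment_mem:
  fixes a b c x y :: real
  assumes "convex H" "0 < a" "a < b" "0 < c"
    and arc: "\<And>t. a \<le> t \<Longrightarrow> t \<le> b \<Longrightarrow> (t, c / t, c) \<in> H"
    and "0 < x" "c \<le> x * y" and chord: "c * x + a * b * y \<le> c * (a + b)"
  shows "(x, y, c) \<in> H"
proof -
  have ab: "0 < a * b" using assms by simp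
  have "c * x * x + a * b * c \<le> c * x * x + a * b * (x * y)"
    using mult_left_mono[OF assms(7), of "a * b"] ab by simp
  also have "\<dots> = (c * x + a * b * y) * x" by (simp add: algebra_simps)
  also have "\<dots> \<le> c * (a + b) * x" using chord assms(6) by simp
  finally have "c * ((x - a) * (x - b)) \<le> 0" by (simp add: algebra_simps)
  then have "(x - a) * (x - b) \<le> 0" using \<open>0 < c\<close> by (simp add: mult_le_0_iff)
  then have xa: "a \<le> x" and xb: "x \<le> b" using \<open>a < b\<close> by (auto simp: mult_le_0_iff)
  \<comment> \<open>The value of the second coordinate on the chord above \<open>x\<close>.\<close>
  define y2 where "y2 = c * (a + b - x) / (a * b)"
  have "(x, y2, c) \<in> H"
  proof (rule convex_triple[OF assms(1) arc[of a] arc[of b], where t = "(b - x) / (b - a)"])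
    show "y2 = (b - x) / (b - a) * (c / a) + (1 - (b - x) / (b - a)) * (c / b)"
      "x = (b - x) / (b - a) * a + (1 - (b - x) / (b - a)) * b"
      using assms(2,3) unfolding y2_def by (simp_all add: divide_simps) (simp_all add: algebra_simps)
  qed (use xa xb assms(3) in \<open>auto simp: algebra_simps\<close>)
  have y1: "c / x \<le> y" using assms by (simp add: field_simps)
  have y2: "y \<le> y2" using chord ab unfolding y2_def by (simp add: field_simps)
  show ?thesis
  proof (cases "c / x = y2")
    case True
    then show ?thesis using y1 y2 \<open>(x, y2, c) \<in> H\<close> by simp
  next
    case False
    then have "c / x < y2" using y1 y2 by simp
    show ?thesis
    proof (rule convex_triple[OF assms(1) \<open>(x, y2, c) \<in> H\<close> arc[OF xa xb],
          where t = "(y - c / x) / (y2 - c / x)"])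
      have "(y - c / x) / (y2 - c / x) * (y2 - c / x) = y - c / x"
        using \<open>c / x < y2\<close> by simp
      then show "y = (y - c / x) / (y2 - c / x) * y2 + (1 - (y - c / x) / (y2 - c / x)) * (c / x)"
        by (simp only: left_diff_distrib right_diff_distrib)
    qed (use y1 y2 \<open>c / x < y2\<close> in \<open>auto simp: algebra_simps\<close>)
  qed
qed

text \<open>The four points lie in pairs on the two rays from \<open>C\<close> with directions
  \<open>e\<close> and \<open>f\<close>. The line from \<open>C\<close> through the given point
  meets the segment of the first pair \<open>a1\<close>, \<open>b1\<close> at factor
  \<open>1 / D1\<close> and that of the second pair at \<open>1 / D2\<close>; since
  \<open>1 / D1 \<le> 1 \<le> 1 / D2\<close>, the point lies between two members of
  \<open>H\<close>. \<open>C\<close> itself may lie outside \<open>H\<close>.\<close>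

lemma quadrilateral_mem:
  fixes C e f :: "'a::real_vector"
  assumes "convex H" "0 < a1" "0 < a2" "0 < b1" "0 < b2"
    and a: "C + a1 *\<^sub>R e \<in> H" "C + a2 *\<^sub>R e \<in> H"
    and b: "C + b1 *\<^sub>R f \<in> H" "C + b2 *\<^sub>R f \<in> H"
    and "0 \<le> X" "0 \<le> Y" "1 \<le> X / a1 + Y / b1" "X / a2 + Y / b2 \<le> 1"
  shows "C + X *\<^sub>R e + Y *\<^sub>R f \<in> H"
proof -
  \<comment> \<open>Division by \<open>D\<close> moves the point radially onto the segment between
    the two given members, with weights \<open>X / (p * D)\<close> and
    \<open>Y / (q * D)\<close>.\<close>
  have side: "C + (X / D) *\<^sub>R e + (Y / D) *\<^sub>R f \<in> H"
    if "0 < p" "0 < q" "C + p *\<^sub>R e \<in> H" "C + q *\<^sub>R f \<in> H" "D = X / p + Y / q" "0 < D" for p q D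
  proof -
    have "(X / (p * D)) *\<^sub>R (C + p *\<^sub>R e) + (Y / (q * D)) *\<^sub>R (C + q *\<^sub>R f) \<in> H"
    proof (rule convexD[OF assms(1) that(3,4)])
      have "X / (p * D) + Y / (q * D) = (X / p + Y / q) / D" by (simp add: add_divide_distrib)
      then show "X / (p * D) + Y / (q * D) = 1" using that by simp
    qed (use that assms in auto)
    also have "(X / (p * D)) *\<^sub>R (C + p *\<^sub>R e) + (Y / (q * D)) *\<^sub>R (C + q *\<^sub>R f)
        = (X / (p * D) + Y / (q * D)) *\<^sub>R C + (X / D) *\<^sub>R e + (Y / D) *\<^sub>R f"
      using that(1,2) by (simp add: algebra_simps)
    also have "X / (p * D) + Y / (q * D) = (X / p + Y / q) / D" by (simp add: add_divide_distrib)
    also have "\<dots> = 1" using that by simp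
    finally show ?thesis by simp
  qed
  define D1 D2 where "D1 = X / a1 + Y / b1" and "D2 = X / a2 + Y / b2"
  have D1: "1 \<le> D1" using assms D1_def by simp
  have "0 < D2"
  proof (rule ccontr)
    assume "\<not> 0 < D2"
    moreover have "0 \<le> X / a2" "0 \<le> Y / b2" using assms by auto
    ultimately have "X / a2 = 0" "Y / b2 = 0" unfolding D2_def by linarith+
    then show False using D1 assms(2-5) unfolding D1_def by simp
  qed
  have D2: "D2 \<le> 1" using assms D2_def by simp
  have p1: "C + (X / D1) *\<^sub>R e + (Y / D1) *\<^sub>R f \<in> H"
    using side[of a1 b1 D1] assms D1 D1_def by simp
  have p2: "C + (X / D2) *\<^sub>R e + (Y / D2) *\<^sub>R f \<in> H"
    using side[of a2 b2 D2] assms \<open>0 < D2\<close> D2_def by simp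
  define P where "P = (\<lambda>s. C + s *\<^sub>R (X *\<^sub>R e + Y *\<^sub>R f))"
  have P: "P (1 / D1) \<in> H" "P (1 / D2) \<in> H"
    using p1 p2 unfolding P_def by (simp_all add: algebra_simps)
  have "P 1 \<in> H"
  proof (cases "D1 = D2")
    case True
    then show ?thesis using P D1 D2 by simp
  next
    case False
    then have lt: "1 / D1 < 1 / D2" using D1 D2 \<open>0 < D2\<close> by (simp add: field_simps)
    define t where "t = (1 - 1 / D1) / (1 / D2 - 1 / D1)"
    have t: "t * (1 / D2) + (1 - t) * (1 / D1) = 1"
    proof -
      have "t * (1 / D2 - 1 / D1) = 1 - 1 / D1" 
        by (rule nonzero_eq_divide_eq[THEN iffD1, OF _ t_def]) (use lt in linarith)
      then show ?thesis by (simp add: algebra_simps diff_divide_distrib)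
    qed
    have "1 / D1 \<le> 1" "1 \<le> 1 / D2" using D1 D2 \<open>0 < D2\<close> by simp_all
    then have "0 \<le> t" "t \<le> 1" unfolding t_def using lt by simp_all
    then have "t *\<^sub>R P (1 / D2) + (1 - t) *\<^sub>R P (1 / D1) \<in> H"
      by (intro convexD[OF assms(1)] P) auto
    also have "t *\<^sub>R P (1 / D2) + (1 - t) *\<^sub>R P (1 / D1)
        = C + (t * (1 / D2) + (1 - t) * (1 / D1)) *\<^sub>R (X *\<^sub>R e + Y *\<^sub>R f)"
      unfolding P_def by (simp only: scaleR_add_right scaleR_add_left scaleR_scaleR)
        (simp add: algebra_simps)
    finally show ?thesis unfolding t P_def .
  qed
  then show ?thesis unfolding P_def by (simp add: algebra_simps)
qed

text \<open>Here \<open>a = lx\<close>, \<open>b = ly\<close>, \<open>r = sqrt lz\<close>, \<open>R = sqrt uz\<close>. The convex set \<open>H\<close> is kept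
  abstract so that exchanging \<open>x\<close> and \<open>y\<close> yields another instance.\<close>
locale cut_box =
  fixes a b r R :: real and H :: "(real \<times> real \<times> real) set"
  assumes r_pos: "0 < r" and r_less: "r < R" and R_less: "R < 1"
    and a_ge: "r\<^sup>2 \<le> a" and a_le: "a \<le> r * R"
    and b_ge: "r\<^sup>2 \<le> b" and b_le: "b \<le> r * R"
    and ab_less: "a * b < r\<^sup>2"
    and H: "convex H"
    and mem: "\<lbrakk>a \<le> x; x \<le> 1; b \<le> y; y \<le> 1; r\<^sup>2 \<le> x * y; x * y \<le> R\<^sup>2\<rbrakk> \<Longrightarrow> (x, y, x * y) \<in> H"
begin

section \<open>Order relations among the parameters, and the exchange of coordinates\<close>

lemma a_pos: "0 < a" and b_pos: "0 < b"
  using a_ge b_ge r_pos by (smt (verit) zero_less_power)+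

lemma rR_less: "r * R < R\<^sup>2" and r2_less: "r\<^sup>2 < r * R" and R2_less: "R\<^sup>2 < R" and rR_less_r: "r * R < r"
  using r_pos r_less R_less by (simp_all add: power2_eq_square)

lemma a_less: "a < R\<^sup>2" and b_less: "b < R\<^sup>2" and a_less_1: "a < 1" and b_less_1: "b < 1"
  using rR_less R2_less R_less a_le b_le by linarith+

lemma r2_less_R2: "r\<^sup>2 < R\<^sup>2" and R2_less_1: "R\<^sup>2 < 1"
  using rR_less R2_less R_less r2_less by linarith+

lemma ab_le: "a * b \<le> r * R"
  using ab_less r2_less by linarith

lemma swap: "cut_box b a r R {(x, y, z). (y, x, z) \<in> H}"
proof
  show "convex {(x, y, z). (y, x, z) \<in> H}"
    using convex_linear_vimage[OF linear_swap12 H] by (simp add: vimage_def case_prod_unfold)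
next
  fix x y assume "b \<le> x" "x \<le> 1" "a \<le> y" "y \<le> 1" "r\<^sup>2 \<le> x * y" "x * y \<le> R\<^sup>2"
  then show "(x, y, x * y) \<in> {(x, y, z). (y, x, z) \<in> H}"
    using mem[of y x] by (simp add: mult.commute)
qed (use r_pos r_less R_less a_ge a_le b_ge b_le ab_less in \<open>simp_all add: mult.commute\<close>)

section \<open>Planar pieces of the hull: hyperbolic segments and RLT quadrilaterals\<close>

text \<open>The RLT plane \<open>z = b * x + a * y - a * b\<close> cuts the plane
  \<open>z = lz\<close> in the line through the arc's end points \<open>(a, lz / a)\<close> and
  \<open>(lz / b, b)\<close>, so the RLT inequality is the chord condition.\<close>

lemma lower_face:
  assumes "0 < x" "r\<^sup>2 \<le> x * y" "b * x + a * y - a * b \<le> r\<^sup>2"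
  shows "(x, y, r\<^sup>2) \<in> H"
proof (rule hyperbola_segment_mem[OF H, where a = a and b = "r\<^sup>2 / b"])
  show "0 < a" by (rule a_pos)
  show "a < r\<^sup>2 / b" using ab_less b_pos by (simp add: field_simps)
  show "0 < r\<^sup>2" using r_pos by simp
  show "(t, r\<^sup>2 / t, r\<^sup>2) \<in> H" if "a \<le> t" "t \<le> r\<^sup>2 / b" for t
  proof -
    have "0 < t" using that a_pos by simp
    have "r\<^sup>2 / b \<le> 1" using b_ge b_pos by (simp add: field_simps)
    then have 1: "t \<le> 1" using that by linarith
    have 2: "b \<le> r\<^sup>2 / t" using that b_pos \<open>0 < t\<close> by (simp add: field_simps)
    have 3: "r\<^sup>2 / t \<le> 1" using that a_ge \<open>0 < t\<close> by (simp add: field_simps)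
    show ?thesis using mem[of t "r\<^sup>2 / t"] that 1 2 3 \<open>0 < t\<close> r2_less_R2 by simp
  qed
  have "r\<^sup>2 / b * (b * x + a * y) \<le> r\<^sup>2 / b * (r\<^sup>2 + a * b)"
    using assms(3) b_pos by (intro mult_left_mono) auto
  then show "r\<^sup>2 * x + a * (r\<^sup>2 / b) * y \<le> r\<^sup>2 * (a + r\<^sup>2 / b)"
    using b_pos by (simp add: field_simps)
qed (use assms in auto)

text \<open>Here the chord joins \<open>(uz, 1)\<close> and \<open>(1, uz)\<close>, which is where
  the plane \<open>z = x + y - 1\<close> meets \<open>z = uz\<close>.\<close>

lemma upper_face:
  assumes "0 < x" "R\<^sup>2 \<le> x * y" "x + y \<le> 1 + R\<^sup>2"
  shows "(x, y, R\<^sup>2) \<in> H"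
proof (rule hyperbola_segment_mem[OF H, where a = "R\<^sup>2" and b = 1])
  have R0: "0 < R\<^sup>2" using r_pos r_less by simp
  show "0 < R\<^sup>2" "0 < R\<^sup>2" by (rule R0)+
  show "R\<^sup>2 < 1" by (rule R2_less_1)
  show "(t, R\<^sup>2 / t, R\<^sup>2) \<in> H" if "R\<^sup>2 \<le> t" "t \<le> 1" for t
  proof -
    have "0 < t" using that R0 by linarith
    have 1: "R\<^sup>2 / t \<le> 1" using that \<open>0 < t\<close> by (simp add: field_simps)
    have "R\<^sup>2 * t \<le> R\<^sup>2 * 1" using that by (intro mult_left_mono) auto
    then have 2: "R\<^sup>2 \<le> R\<^sup>2 / t" using \<open>0 < t\<close> by (simp add: field_simps)
    show ?thesis using mem[of t "R\<^sup>2 / t"] that 1 2 \<open>0 < t\<close> r2_less_R2 a_less b_less by simp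
  qed
  have "R\<^sup>2 * (x + y) \<le> R\<^sup>2 * (1 + R\<^sup>2)"
    using assms(3) by (intro mult_left_mono) auto
  then show "R\<^sup>2 * x + R\<^sup>2 * 1 * y \<le> R\<^sup>2 * (R\<^sup>2 + 1)" by (simp add: algebra_simps)
qed (use assms in auto)

lemma corner_mem:
  "(a, 1, a) \<in> H" "(1, b, b) \<in> H" "(R\<^sup>2, 1, R\<^sup>2) \<in> H" "(1, R\<^sup>2, R\<^sup>2) \<in> H"
  using mem[of a 1] mem[of 1 b] mem[of "R\<^sup>2" 1] mem[of 1 "R\<^sup>2"]
    a_ge b_ge a_less b_less a_less_1 b_less_1 r2_less_R2 R2_less_1 by simp_all

lemma lower_corner_mem: "(a, r\<^sup>2 / a, r\<^sup>2) \<in> H" "(r\<^sup>2 / b, b, r\<^sup>2) \<in> H"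
proof -
  have "b \<le> r\<^sup>2 / a" "a \<le> r\<^sup>2 / b" "r\<^sup>2 / a \<le> 1" "r\<^sup>2 / b \<le> 1"
    using ab_less a_pos b_pos a_ge b_ge by (simp_all add: field_simps)
  then show "(a, r\<^sup>2 / a, r\<^sup>2) \<in> H" "(r\<^sup>2 / b, b, r\<^sup>2) \<in> H"
    using mem[of a "r\<^sup>2 / a"] mem[of "r\<^sup>2 / b" b] a_pos b_pos a_less_1 b_less_1 r2_less_R2
    by simp_all
qed

text \<open>The corner \<open>C\<close> of the box has height \<open>a * b\<close>, below
  \<open>lz\<close>. The rays from \<open>C\<close> are the box edges \<open>y = b\<close> and
  \<open>x = a\<close> lifted to the plane; one side of the quadrilateral lies on
  \<open>z = lz\<close>, the opposite one on \<open>z = x + y - 1\<close>.\<close>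

lemma lower_RLT_face:
  assumes "a \<le> x" "b \<le> y" and z: "z = b * x + a * y - a * b"
    and "r\<^sup>2 \<le> z" "x + y - 1 \<le> z"
  shows "(x, y, z) \<in> H"
proof -
  let ?C = "(a, b, a * b)" and ?e = "(1::real, 0::real, b)" and ?f = "(0::real, 1::real, a)"
  have d: "0 < r\<^sup>2 - a * b" using ab_less by simp
  have "?C + (x - a) *\<^sub>R ?e + (y - b) *\<^sub>R ?f \<in> H"
  proof (rule quadrilateral_mem[OF H, where ?a1.0 = "(r\<^sup>2 - a * b) / b" and ?b1.0 = "(r\<^sup>2 - a * b) / a"
        and ?a2.0 = "1 - a" and ?b2.0 = "1 - b"])
    show "?C + ((r\<^sup>2 - a * b) / b) *\<^sub>R ?e \<in> H" "?C + ((r\<^sup>2 - a * b) / a) *\<^sub>R ?f \<in> H"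
      "?C + (1 - a) *\<^sub>R ?e \<in> H" "?C + (1 - b) *\<^sub>R ?f \<in> H"
      using lower_corner_mem corner_mem(1,2) a_pos b_pos by (simp_all add: field_simps)
    have "(x - a) / ((r\<^sup>2 - a * b) / b) + (y - b) / ((r\<^sup>2 - a * b) / a)
      = (z - a * b) / (r\<^sup>2 - a * b)"
      unfolding z using d by (simp add: divide_simps) (simp add: algebra_simps)
    then show "1 \<le> (x - a) / ((r\<^sup>2 - a * b) / b) + (y - b) / ((r\<^sup>2 - a * b) / a)"
      using d assms(4) by simp
    have "(x - a) * (1 - b) + (y - b) * (1 - a) \<le> (1 - a) * (1 - b)"
      using assms(5) unfolding z by (simp add: algebra_simps)
    then show "(x - a) / (1 - a) + (y - b) / (1 - b) \<le> 1"
      using a_less_1 b_less_1 by (simp add: divide_simps)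
  qed (use a_pos b_pos a_less_1 b_less_1 d assms in auto)
  then show ?thesis by (simp add: z algebra_simps)
qed

text \<open>The mirror situation, seen from the corner \<open>(1, 1, 1)\<close> above
  \<open>z = uz\<close>: the sides lie on \<open>z = uz\<close> and on the other RLT plane.\<close>

lemma upper_RLT_face:
  assumes "x \<le> 1" "y \<le> 1" and z: "z = x + y - 1"
    and "z \<le> R\<^sup>2" "b * x + a * y - a * b \<le> z"
  shows "(x, y, z) \<in> H"
proof -
  let ?C = "(1::real, 1::real, 1::real)" and ?e = "(-1::real, 0::real, -1::real)" and ?f = "(0::real, -1::real, -1::real)"
  have d: "0 < 1 - R\<^sup>2" using R2_less_1 by simp
  have "?C + (1 - x) *\<^sub>R ?e + (1 - y) *\<^sub>R ?f \<in> H"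
  proof (rule quadrilateral_mem[OF H, where ?a1.0 = "1 - R\<^sup>2" and ?b1.0 = "1 - R\<^sup>2"
        and ?a2.0 = "1 - a" and ?b2.0 = "1 - b"])
    show "?C + (1 - R\<^sup>2) *\<^sub>R ?e \<in> H" "?C + (1 - R\<^sup>2) *\<^sub>R ?f \<in> H"
      "?C + (1 - a) *\<^sub>R ?e \<in> H" "?C + (1 - b) *\<^sub>R ?f \<in> H"
      using corner_mem by simp_all
    show "1 \<le> (1 - x) / (1 - R\<^sup>2) + (1 - y) / (1 - R\<^sup>2)"
      using d assms(4) unfolding z by (simp add: add_divide_distrib[symmetric])
    have "(1 - x) * (1 - b) + (1 - y) * (1 - a) \<le> (1 - a) * (1 - b)"
      using assms(5) unfolding z by (simp add: algebra_simps)
    then show "(1 - x) / (1 - a) + (1 - y) / (1 - b) \<le> 1"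
      using a_less_1 b_less_1 by (simp add: divide_simps)
  qed (use a_less_1 b_less_1 d assms in auto)
  then show ?thesis by (simp add: z algebra_simps)
qed

section \<open>Middle region: rays through the apex \<open>W\<close>\<close>

text \<open>The cone inequality is homogeneous in \<open>(x, y, z + r * R)\<close>. Since
  \<open>lz + r * R = r * (r + R)\<close> and \<open>uz + r * R = R * (r + R)\<close>, taking
  \<open>c = r\<close> or \<open>c = R\<close> gives the arc condition in the plane
  \<open>z = lz\<close> or \<open>z = uz\<close>.\<close>

lemma cone_scale:
  assumes cone: "(z + r * R)\<^sup>2 \<le> (r + R)\<^sup>2 * (x * y)"
    and "0 \<le> c" "c * (r + R) \<le> s * (z + r * R)"
  shows "c\<^sup>2 \<le> (s * x) * (s * y)"
proof -
  have rR: "0 < (r + R)\<^sup>2" using r_pos r_less by simp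
  have "(r + R)\<^sup>2 * c\<^sup>2 = (c * (r + R))\<^sup>2" by (simp add: power_mult_distrib)
  also have "\<dots> \<le> (s * (z + r * R))\<^sup>2"
    using assms r_pos r_less by (intro power_mono) auto
  also have "\<dots> = s\<^sup>2 * (z + r * R)\<^sup>2" by (simp add: power_mult_distrib)
  also have "\<dots> \<le> s\<^sup>2 * ((r + R)\<^sup>2 * (x * y))"
    using cone by (intro mult_left_mono) auto
  also have "\<dots> = (r + R)\<^sup>2 * ((s * x) * (s * y))" by (simp add: power2_eq_square)
  finally show ?thesis using rR by simp
qed

text \<open>The points \<open>(s * x, s * y, s * (z + r * R) - r * R)\<close> form the line through \<open>W\<close> and \<open>(x, y, z)\<close>.\<close>
lemma ray_up:
  assumes x: "0 < x" and reg: "R\<^sup>2 * x \<le> y" "R\<^sup>2 * y \<le> x"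
    and cone: "(z + r * R)\<^sup>2 \<le> (r + R)\<^sup>2 * (x * y)"
    and rlt: "x + y - 1 \<le> z" "b * x + a * y - a * b \<le> z" and z: "r\<^sup>2 \<le> z" "z \<le> R\<^sup>2"
  shows "\<exists>s\<ge>1. (s * x, s * y, s * (z + r * R) - r * R) \<in> H"
proof -
  define k where "k = z + r * R"
  have pos: "0 < r * R" "0 < r\<^sup>2" using r_pos r_less by auto
  then have k: "0 < k" using z unfolding k_def by linarith
  \<comment> \<open>The parameter at which the line reaches \<open>z = uz\<close>.\<close>
  define S where "S = (R\<^sup>2 + r * R) / k"
  have Sk: "S * k = R\<^sup>2 + r * R" using k by (simp add: S_def)
  have S1: "1 \<le> S" using k z by (simp add: S_def k_def)
  show ?thesis
  proof (cases "S * x + S * y \<le> 1 + R\<^sup>2")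
    case True
    have "R\<^sup>2 \<le> (S * x) * (S * y)"
      using Sk r_pos r_less by (intro cone_scale[OF cone]) (simp_all add: k_def algebra_simps power2_eq_square)
    then have "(S * x, S * y, R\<^sup>2) \<in> H" using True S1 x by (intro upper_face) auto
    then show ?thesis using Sk S1 by (intro exI[of _ S]) (simp add: k_def)
  next
    case False
    define d where "d = x + y - k"
    \<comment> \<open>The parameter at which the line meets \<open>z = x + y - 1\<close>; when the
      point at \<open>S\<close> is beyond the chord, this happens no later than
      \<open>S\<close>.\<close>
    define s where "s = (1 - r * R) / d"
    have "0 < S * d" using False Sk rR_less R2_less_1 unfolding d_def by (simp add: algebra_simps)
    then have d: "0 < d" using S1 by (simp add: zero_less_mult_iff)
    have sd: "s * d = 1 - r * R" using d by (simp add: s_def)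
    have s1: "1 \<le> s" using d rlt(1) by (simp add: s_def d_def k_def)
    have "s * d < S * d" using False Sk unfolding sd by (simp add: d_def algebra_simps)
    then have sS: "s \<le> S" using d by simp
    have sk: "s * k \<le> R\<^sup>2 + r * R" using sS k Sk by (metis less_imp_le mult_right_mono)
    have plane: "s * k - r * R = s * x + s * y - 1" using sd by (simp add: d_def algebra_simps)
    have reg': "R\<^sup>2 * (s * x) \<le> s * y" "R\<^sup>2 * (s * y) \<le> s * x"
      using mult_left_mono[OF reg(1), of s] mult_left_mono[OF reg(2), of s] s1
      by (simp_all add: algebra_simps)
    have R1: "0 < 1 + R\<^sup>2" by (simp add: add_pos_nonneg)
    \<comment> \<open>The region condition gives
      \<open>(1 + uz) * (s * x) \<le> s * x + s * y\<close>, and on the plane this sum is at most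
      \<open>1 + uz\<close>.\<close>
    have "(1 + R\<^sup>2) * (s * x) \<le> (1 + R\<^sup>2) * 1" "(1 + R\<^sup>2) * (s * y) \<le> (1 + R\<^sup>2) * 1"
      using reg' plane sk by (simp_all add: algebra_simps)
    then have "s * x \<le> 1" "s * y \<le> 1" using R1 by (simp_all only: mult_le_cancel_left_pos)
    \<comment> \<open>As \<open>a * b \<le> r * R\<close>, the apex does not lie strictly inside
      this half-space, so moving away from the apex preserves the inequality.\<close>
    moreover have "b * (s * x) + a * (s * y) - a * b \<le> s * k - r * R"
    proof -
      have "r * R - a * b \<le> 1 * (k - b * x - a * y)" using rlt(2) by (simp add: k_def)
      also have "\<dots> \<le> s * (k - b * x - a * y)"
        using s1 rlt(2) ab_le by (intro mult_right_mono) (auto simp: k_def)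
      finally show ?thesis by (simp add: algebra_simps)
    qed
    ultimately have "(s * x, s * y, s * k - r * R) \<in> H"
      using plane sk by (intro upper_RLT_face) auto
    then show ?thesis using s1 by (auto simp: k_def)
  qed
qed

text \<open>Moving towards \<open>W\<close>, the line reaches \<open>z = lz\<close> inside the
  hyperbolic segment, or else meets the lower RLT plane no later. Region B keeps the latter point
  above the lower bounds of the box.\<close>

lemma ray_down:
  assumes x: "0 < x" "0 < y" and reg: "R\<^sup>2 * x \<le> y" "R\<^sup>2 * y \<le> x"
    and cone: "(z + r * R)\<^sup>2 \<le> (r + R)\<^sup>2 * (x * y)"
    and rlt: "x + y - 1 \<le> z" "b * x + a * y - a * b \<le> z" and z: "r\<^sup>2 \<le> z" "z \<le> R\<^sup>2"
  shows "\<exists>s. s \<le> 1 \<and> (s * x, s * y, s * (z + r * R) - r * R) \<in> H"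
proof -
  define k where "k = z + r * R"
  have pos: "0 < r * R" "0 < r\<^sup>2" using r_pos r_less by auto
  then have k: "0 < k" using z unfolding k_def by linarith
  define S where "S = (r\<^sup>2 + r * R) / k"
  have Sk: "S * k = r\<^sup>2 + r * R" using k by (simp add: S_def)
  have S1: "S \<le> 1" using k z by (simp add: S_def k_def)
  have S0: "0 < S" using k pos unfolding S_def by (intro divide_pos_pos) linarith+
  have arc: "r\<^sup>2 \<le> (s * x) * (s * y)" if "S \<le> s" for s
  proof (rule cone_scale[OF cone])
    have "r * (r + R) = S * k" using Sk by (simp add: algebra_simps power2_eq_square)
    also have "\<dots> \<le> s * k" using that k by (intro mult_right_mono) auto
    finally show "r * (r + R) \<le> s * (z + r * R)" by (simp add: k_def)
  qed (use r_pos in simp)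
  show ?thesis
  proof (cases "b * (S * x) + a * (S * y) - a * b \<le> r\<^sup>2")
    case True
    have "(S * x, S * y, r\<^sup>2) \<in> H" using True S0 x arc[of S] by (intro lower_face) auto
    then show ?thesis using Sk S1 by (intro exI[of _ S]) (simp add: k_def)
  next
    case False
    define d where "d = k - b * x - a * y"
    define s where "s = (r * R - a * b) / d"
    have Sd: "S * d < r * R - a * b" using False Sk unfolding d_def by (simp add: algebra_simps)
    have dge: "r * R - a * b \<le> d" using rlt(2) by (simp add: d_def k_def)
    have d: "0 < d"
    proof (rule ccontr)
      assume "\<not> 0 < d"
      then have "d = 0" using dge ab_le by linarith
      then show False using Sd dge by simp
    qed
    have sd: "s * d = r * R - a * b" using d by (simp add: s_def)
    have s1: "s \<le> 1" using d dge by (simp add: s_def)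
    have "S * d < s * d" using Sd sd by simp
    then have sS: "S \<le> s" using d by simp
    then have s0: "0 < s" using S0 by linarith
    have sk: "r\<^sup>2 + r * R \<le> s * k" using sS k Sk by (metis less_imp_le mult_right_mono)
    have plane: "s * k - r * R = b * (s * x) + a * (s * y) - a * b"
      using sd by (simp add: d_def algebra_simps)
    \<comment> \<open>On the region, \<open>u\<close> is at least \<open>uz * v\<close>, so
      \<open>u * v\<close> bounded below forces \<open>u\<close> to be large. The resulting bound
      \<open>r * R = sqrt (lz * uz)\<close> is exactly the upper limit for \<open>a\<close> and
      \<open>b\<close> in region B.\<close>
    have bound: "r * R \<le> s * u" if "0 < u" "0 < v" "R\<^sup>2 * v \<le> u" "r\<^sup>2 \<le> (s * u) * (s * v)" for u v
    proof (rule power2_le_imp_le)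
      have "(r * R)\<^sup>2 = R\<^sup>2 * r\<^sup>2" by (simp add: power_mult_distrib)
      also have "\<dots> \<le> R\<^sup>2 * ((s * u) * (s * v))" using that by (intro mult_left_mono) auto
      also have "\<dots> = (s * s * u) * (R\<^sup>2 * v)" by simp
      also have "\<dots> \<le> (s * s * u) * u" using that s0 by (intro mult_left_mono) auto
      also have "\<dots> = (s * u)\<^sup>2" by (simp add: power2_eq_square)
      finally show "(r * R)\<^sup>2 \<le> (s * u)\<^sup>2" .
    qed (use s0 that in auto)
    have "a \<le> s * x" "b \<le> s * y"
      using bound[of x y] bound[of y x] x reg arc[OF sS] a_le b_le by (auto simp: mult.commute)
    \<comment> \<open>The apex satisfies this inequality because \<open>r * R < 1\<close>, so it
      survives moving towards the apex.\<close>
    moreover have "s * x + s * y - 1 \<le> s * k - r * R"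
    proof -
      have "1 * (r * R - 1) \<le> s * (r * R - 1)"
        using s1 rR_less R2_less_1 by (intro mult_right_mono_neg) auto
      also have "\<dots> \<le> s * (k - x - y)"
        using s0 rlt(1) by (intro mult_left_mono) (auto simp: k_def)
      finally show ?thesis by (simp add: algebra_simps)
    qed
    ultimately have "(s * x, s * y, s * k - r * R) \<in> H"
      using plane sk by (intro lower_RLT_face) auto
    then show ?thesis using s1 by (auto simp: k_def)
  qed
qed

text \<open>The point has parameter 1 on the line through \<open>W\<close>, between the members of
  \<open>H\<close> supplied by \<open>ray_up\<close> and \<open>ray_down\<close>.\<close>

lemma middle_region:
  assumes "0 < x" "0 < y" "R\<^sup>2 * x \<le> y" "R\<^sup>2 * y \<le> x"
    and "(z + r * R)\<^sup>2 \<le> (r + R)\<^sup>2 * (x * y)"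
    and "x + y - 1 \<le> z" "b * x + a * y - a * b \<le> z" "r\<^sup>2 \<le> z" "z \<le> R\<^sup>2"
  shows "(x, y, z) \<in> H"
proof -
  obtain s where s: "1 \<le> s" "(s * x, s * y, s * (z + r * R) - r * R) \<in> H"
    using ray_up[of x y z] assms by blast
  obtain s' where s': "s' \<le> 1" "(s' * x, s' * y, s' * (z + r * R) - r * R) \<in> H"
    using ray_down[of x y z] assms by blast
  show ?thesis
  proof (cases "s = s'")
    case True
    then have "s = 1" using s s' by simp
    then show ?thesis using s by simp
  next
    case False
    then have lt: "s' < s" using s s' by simp
    define t where "t = (1 - s') / (s - s')"
    have t: "0 \<le> t" "t \<le> 1" using lt s s' by (auto simp: t_def)
    have "t * (s - s') = 1 - s'" using lt by (simp add: t_def)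
    then have e: "t * s + (1 - t) * s' = 1" by (simp add: algebra_simps)
    have e': "w = t * (s * w) + (1 - t) * (s' * w)" for w
    proof -
      have "w = (t * s + (1 - t) * s') * w" using e by simp
      then show ?thesis by (simp add: algebra_simps)
    qed
    show ?thesis
    proof (rule convex_triple[OF H s(2) s'(2) t e' e'])
      show "z = t * (s * (z + r * R) - r * R) + (1 - t) * (s' * (z + r * R) - r * R)"
        using e'[of "z + r * R"] by (simp add: algebra_simps)
    qed
  qed
qed

section \<open>Outer regions: rays through the apex of the second constraint\<close>

text \<open>Projection from the apex \<open>(1, uz, uz)\<close>; \<open>(xq, yq)\<close> is the image in the plane \<open>z = lz\<close>.
  The hypotheses \<open>lin\<close> and \<open>cone\<close> express the conic constraint without the square root.\<close>
lemma right_region: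
  assumes reg: "y \<le> R\<^sup>2 * x" and lin: "0 \<le> R\<^sup>2 * x + y - 2 * z"
    and cone: "0 \<le> (R\<^sup>2 - z)\<^sup>2 - (R\<^sup>2 - z) * (R\<^sup>2 * (1 - x) + (R\<^sup>2 - y)) + (R\<^sup>2 - r\<^sup>2) * ((1 - x) * (R\<^sup>2 - y))"
    and rlt: "x + y - 1 \<le> z" "b * x + a * y - a * b \<le> z" "z \<le> b * x + y - b"
    and z: "r\<^sup>2 \<le> z" "z \<le> R\<^sup>2"
  shows "(x, y, z) \<in> H"
proof (cases "z = R\<^sup>2")
  \<comment> \<open>At the height of the apex there is no projection to \<open>z = lz\<close>; the
    constraints leave only the apex itself.\<close>
  case True
  have D: "0 < R\<^sup>2 - r\<^sup>2" using r2_less_R2 by simp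
  have p: "0 \<le> (1 - x) * (R\<^sup>2 - y)" using cone D unfolding True by (simp add: zero_le_mult_iff)
  have w: "R\<^sup>2 * (1 - x) + (R\<^sup>2 - y) \<le> 0" using lin unfolding True by (simp add: algebra_simps)
  have R0: "0 < R\<^sup>2" using r_pos r_less by simp
  have "1 \<le> x"
  proof (rule ccontr)
    assume *: "\<not> 1 \<le> x"
    then have "0 \<le> R\<^sup>2 - y" using p by (simp add: zero_le_mult_iff)
    moreover have "0 < R\<^sup>2 * (1 - x)" using * R0 by simp
    ultimately show False using w by linarith
  qed
  moreover have "R\<^sup>2 \<le> y"
  proof (rule ccontr)
    assume *: "\<not> R\<^sup>2 \<le> y"
    then have "0 \<le> 1 - x" using p by (simp add: zero_le_mult_iff)
    then have "0 \<le> R\<^sup>2 * (1 - x)" using R0 by simp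
    then show False using w * by linarith
  qed
  ultimately have "x = 1" "y = R\<^sup>2" using rlt(1) True by linarith+
  then show ?thesis using corner_mem True by simp
next
  case False
  define T where "T = R\<^sup>2 - z"
  have T: "0 < T" using False z by (simp add: T_def)
  define D where "D = R\<^sup>2 - r\<^sup>2"
  have D: "0 < D" "T \<le> D" using r2_less_R2 z by (simp_all add: D_def T_def)
  \<comment> \<open>The factor that stretches the segment from the apex to the point until it
    reaches \<open>z = lz\<close>.\<close>
  define N where "N = D / T"
  have NT: "N * T = D" using T by (simp add: N_def)
  have N1: "1 \<le> N" using T D by (simp add: N_def)
  define xq yq where "xq = 1 - N * (1 - x)" and "yq = R\<^sup>2 - N * (R\<^sup>2 - y)"
  define w where "w = R\<^sup>2 * (1 - x) + (R\<^sup>2 - y)"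
  have w: "w \<le> 2 * T" using lin by (simp add: w_def T_def algebra_simps)
  \<comment> \<open>Scaled to the plane \<open>z = lz\<close>, the cone expression becomes a
    multiple of \<open>xq * yq - lz\<close>.\<close>
  have "N\<^sup>2 * (T\<^sup>2 - T * w + D * ((1 - x) * (R\<^sup>2 - y))) = D * (xq * yq - r\<^sup>2)"
  proof -
    have "N\<^sup>2 * (T\<^sup>2 - T * w + D * ((1 - x) * (R\<^sup>2 - y)))
      = (N * T)\<^sup>2 - (N * T) * (N * w) + D * ((N * (1 - x)) * (N * (R\<^sup>2 - y)))"
      by (simp add: algebra_simps power2_eq_square)
    also have "\<dots> = D * (D - N * w + (1 - xq) * (R\<^sup>2 - yq))"
      unfolding NT by (simp add: xq_def yq_def algebra_simps power2_eq_square)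
    also have "N * w = R\<^sup>2 * (1 - xq) + (R\<^sup>2 - yq)"
      by (simp add: w_def xq_def yq_def algebra_simps)
    also have "D * (D - (R\<^sup>2 * (1 - xq) + (R\<^sup>2 - yq)) + (1 - xq) * (R\<^sup>2 - yq)) = D * (xq * yq - r\<^sup>2)"
      by (simp add: D_def algebra_simps)
    finally show ?thesis .
  qed
  moreover have "0 \<le> N\<^sup>2 * (T\<^sup>2 - T * w + D * ((1 - x) * (R\<^sup>2 - y)))"
    using cone by (simp add: T_def D_def w_def)
  ultimately have q: "r\<^sup>2 \<le> xq * yq" using D(1) by (simp add: zero_le_mult_iff)
  have "R\<^sup>2 * xq - yq = N * (R\<^sup>2 * x - y)" by (simp add: xq_def yq_def algebra_simps)
  moreover have "0 \<le> N * (R\<^sup>2 * x - y)" using N1 reg by simp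
  ultimately have regq: "yq \<le> R\<^sup>2 * xq" by simp
  have "N * w \<le> N * (2 * T)" using w N1 by (intro mult_left_mono) auto
  then have Nw: "N * w \<le> 2 * D" using NT by (simp add: algebra_simps)
  have r2: "0 < r\<^sup>2" using r_pos by simp
  have "R\<^sup>2 * xq + yq = 2 * R\<^sup>2 - N * w"
    by (simp add: xq_def yq_def w_def algebra_simps)
  moreover have "N * w \<le> 2 * R\<^sup>2 - 2 * r\<^sup>2" using Nw by (simp add: D_def)
  \<comment> \<open>The linear part of the constraint rules out the branch of the hyperbola with
    negative coordinates.\<close>
  ultimately have sumq: "0 < R\<^sup>2 * xq + yq" using r2 by linarith
  have xq0: "0 < xq"
  proof (rule ccontr)
    assume *: "\<not> 0 < xq"
    have "0 < xq * yq" using q r2 by linarith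
    then have "xq < 0" "yq < 0" using * by (auto simp: zero_less_mult_iff)
    moreover have "R\<^sup>2 * xq \<le> 0" using \<open>xq < 0\<close> by (simp add: mult_nonneg_nonpos)
    ultimately show False using sumq by linarith
  qed
  have axq: "a \<le> xq"
  proof -
    have "r\<^sup>2 \<le> xq * (R\<^sup>2 * xq)" using q regq xq0
      by (meson less_imp_le mult_left_mono order_trans)
    also have "\<dots> = (R * xq)\<^sup>2" by (simp add: power2_eq_square)
    finally have "r \<le> R * xq"
      by (rule power2_le_imp_le) (use r_pos r_less xq0 in simp)
    also have "\<dots> \<le> 1 * xq" using R_less xq0 by (intro mult_right_mono) auto
    finally show ?thesis using a_le rR_less_r by linarith
  qed
  \<comment> \<open>The target is a convex combination of the apex and the stretched point, with
    weight \<open>1 / m\<close> on the latter.\<close>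
  have from_apex: "(x, y, z) \<in> H"
    if "1 \<le> m" "(1 - m * (1 - x), R\<^sup>2 - m * (R\<^sup>2 - y), R\<^sup>2 - m * T) \<in> H" for m
  proof -
    have e: "v = (1 / m) * (c - m * (c - v)) + (1 - 1 / m) * c" for c v :: real
      using that(1) by (simp add: field_simps)
    show ?thesis
      by (rule convex_triple[OF H that(2) corner_mem(4) _ _ e e e[of z "R\<^sup>2", folded T_def]])
        (use that(1) in auto)
  qed
  \<comment> \<open>Slacks of the apex and of the point in the lower RLT inequality; along the ray
    the slack is affine in \<open>m\<close>.\<close>
  define sV sp where "sV = R\<^sup>2 - (b + a * R\<^sup>2 - a * b)" and "sp = z - (b * x + a * y - a * b)"
  have slack: "(R\<^sup>2 - m * T) - (b * (1 - m * (1 - x)) + a * (R\<^sup>2 - m * (R\<^sup>2 - y)) - a * b) = sV - m * (sV - sp)" for m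
    by (simp add: sV_def sp_def T_def algebra_simps)
  have sp: "0 \<le> sp" using rlt(2) by (simp add: sp_def)
  have "sV = (1 - a) * (R\<^sup>2 - b)" by (simp add: sV_def algebra_simps)
  then have sV: "0 < sV" using a_less_1 b_less by simp
  have zN: "R\<^sup>2 - N * T = r\<^sup>2" using NT by (simp add: D_def)
  show ?thesis
  proof (cases "0 \<le> sV - N * (sV - sp)")
    case True
    then have "b * xq + a * yq - a * b \<le> r\<^sup>2" using slack[of N] zN by (simp add: xq_def yq_def)
    then have "(xq, yq, r\<^sup>2) \<in> H" using xq0 q by (intro lower_face)
    then show ?thesis using from_apex[OF N1] zN by (simp add: xq_def yq_def)
  next
    case False
    \<comment> \<open>The factor at which the slack vanishes; it is reached no later than
      \<open>z = lz\<close>.\<close>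
    define m where "m = sV / (sV - sp)"
    have "0 < N * (sV - sp)" using False sV by linarith
    then have d: "0 < sV - sp" using N1 by (simp add: zero_less_mult_iff)
    have md: "m * (sV - sp) = sV" using d by (simp add: m_def)
    have m1: "1 \<le> m" using d sp by (simp add: m_def)
    have "m * (sV - sp) \<le> N * (sV - sp)" using md False by linarith
    then have mN: "m \<le> N" using d by simp
    define x' y' z' where "x' = 1 - m * (1 - x)" and "y' = R\<^sup>2 - m * (R\<^sup>2 - y)" and "z' = R\<^sup>2 - m * T"
    have plane: "z' = b * x' + a * y' - a * b"
      using slack[of m] md by (simp add: x'_def y'_def z'_def)
    have "a \<le> x'"
    proof (cases "x \<le> 1")
      case True
      then have "m * (1 - x) \<le> N * (1 - x)" using mN by (intro mult_right_mono) auto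
      then show ?thesis using axq by (simp add: x'_def xq_def)
    next
      case False
      then have "m * (1 - x) \<le> 0" using m1 by (simp add: mult_nonneg_nonpos)
      then show ?thesis using a_less_1 by (simp add: x'_def)
    qed
    \<comment> \<open>The apex satisfies \<open>z = b * x + y - b\<close> and
      \<open>z = x + y - 1\<close>, so the slacks of these two constraints are simply multiplied by
      \<open>m\<close> along the ray.\<close>
    moreover have "b \<le> y'"
    proof -
      have "(1 - a) * (y' - b) = b * x' + y' - b - z'" unfolding plane by (simp add: algebra_simps)
      also have "\<dots> = m * (b * x + y - b - z)"
        by (simp add: x'_def y'_def z'_def T_def algebra_simps)
      also have "0 \<le> \<dots>" using m1 rlt(3) by simp
      finally show ?thesis using a_less_1 by (simp add: zero_le_mult_iff)
    qed
    moreover have "x' + y' - 1 \<le> z'"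
    proof -
      have "z' - (x' + y' - 1) = m * (z - (x + y - 1))"
        by (simp add: x'_def y'_def z'_def T_def algebra_simps)
      moreover have "0 \<le> m * (z - (x + y - 1))" using m1 rlt(1) by simp
      ultimately show ?thesis by simp
    qed
    moreover have "r\<^sup>2 \<le> z'"
    proof -
      have "m * T \<le> N * T" using mN T by simp
      then show ?thesis using zN by (simp add: z'_def)
    qed
    ultimately have "(x', y', z') \<in> H" using plane by (intro lower_RLT_face) auto
    then show ?thesis using from_apex[OF m1] by (simp add: x'_def y'_def z'_def)
  qed
qed

end

section \<open>Necessity: inequalities valid on the hull\<close>

lemma F'_swap_hull:
  assumes "(x, y, z) \<in> convex hull F' lx ly lz uz"
  shows "(y, x, z) \<in> convex hull F' ly lx lz uz"
proof -
  define f :: "real \<times> real \<times> real \<Rightarrow> real \<times> real \<times> real" where "f = (\<lambda>(x, y, z). (y, x, z))"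
  have "linear f" unfolding f_def by (rule linear_swap12)
  then have "f ` (convex hull F' lx ly lz uz) = convex hull (f ` F' lx ly lz uz)"
    by (rule convex_hull_linear_image)
  also have "f ` F' lx ly lz uz \<subseteq> F' ly lx lz uz" by (auto simp: f_def F'_def mult.commute)
  then have "convex hull (f ` F' lx ly lz uz) \<subseteq> convex hull F' ly lx lz uz" by (rule hull_mono)
  finally show ?thesis using assms by (force simp: f_def)
qed

lemma hull_RLT:
  assumes "(x, y, z) \<in> convex hull F' lx ly lz uz"
  shows "RLT lx ly x y z"
proof -
  have "- 1 \<le> (- 1) * x + (- 1) * y + 1 * z"
  proof (rule affine_ineq_hull[OF _ assms])
    fix x y z assume "(x, y, z) \<in> F' lx ly lz uz"
    then have "0 \<le> (1 - x) * (1 - y)" "z = x * y" by (auto simp: F'_def)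
    then show "- 1 \<le> (- 1) * x + (- 1) * y + 1 * z" by (simp add: algebra_simps)
  qed
  moreover have "- (lx * ly) \<le> (- ly) * x + (- lx) * y + 1 * z"
  proof (rule affine_ineq_hull[OF _ assms])
    fix x y z assume "(x, y, z) \<in> F' lx ly lz uz"
    then have "0 \<le> (x - lx) * (y - ly)" "z = x * y" by (auto simp: F'_def)
    then show "- (lx * ly) \<le> (- ly) * x + (- lx) * y + 1 * z" by (simp add: algebra_simps)
  qed
  moreover have "lx \<le> 1 * x + lx * y + (- 1) * z"
  proof (rule affine_ineq_hull[OF _ assms])
    fix x y z assume "(x, y, z) \<in> F' lx ly lz uz"
    then have "0 \<le> (x - lx) * (1 - y)" "z = x * y" by (auto simp: F'_def)
    then show "lx \<le> 1 * x + lx * y + (- 1) * z" by (simp add: algebra_simps)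
  qed
  moreover have "ly \<le> ly * x + 1 * y + (- 1) * z"
  proof (rule affine_ineq_hull[OF _ assms])
    fix x y z assume "(x, y, z) \<in> F' lx ly lz uz"
    then have "0 \<le> (1 - x) * (y - ly)" "z = x * y" by (auto simp: F'_def)
    then show "ly \<le> ly * x + 1 * y + (- 1) * z" by (simp add: algebra_simps)
  qed
  ultimately show ?thesis by (simp add: RLT_def)
qed

lemma hull_z_bounds:
  assumes "(x, y, z) \<in> convex hull F' lx ly lz uz"
  shows "lz \<le> z" "z \<le> uz"
proof -
  have "lz \<le> 0 * x + 0 * y + 1 * z"
    by (rule affine_ineq_hull[OF _ assms]) (auto simp: F'_def)
  moreover have "- uz \<le> 0 * x + 0 * y + (- 1) * z"
    by (rule affine_ineq_hull[OF _ assms]) (auto simp: F'_def)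
  ultimately show "lz \<le> z" "z \<le> uz" by simp_all
qed

text \<open>The description of the hull has no explicit box bounds; subtracting the lower RLT
  inequality from each of the two upper ones recovers these.\<close>

lemma RLT_imp_ge:
  assumes "RLT lx ly x y z" "lx < 1" "ly < 1"
  shows "lx \<le> x" "ly \<le> y"
proof -
  have "0 \<le> (1 - ly) * (x - lx)" "0 \<le> (1 - lx) * (y - ly)"
    using assms(1) by (simp_all add: RLT_def algebra_simps)
  then show "lx \<le> x" "ly \<le> y" using assms(2,3) by (simp_all add: zero_le_mult_iff)
qed

text \<open>By the arithmetic-geometric mean inequality, the supporting half-spaces of the cone are
  parametrized by \<open>s = sqrt (y / x)\<close>.\<close>
lemma hull_middle_cone:
  assumes p: "(x, y, z) \<in> convex hull F' lx ly (r\<^sup>2) (R\<^sup>2)"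
    and "0 < r" "r < R" "0 < lx" "0 < ly" "0 < x" "0 < y"
  shows "(z + r * R)\<^sup>2 \<le> (r + R)\<^sup>2 * (x * y)"
proof -
  have fam: "2 * (r * R) \<le> ((r + R) * s) * x + ((r + R) / s) * y + (- 2) * z" if "0 < s" for s
  proof (rule affine_ineq_hull[OF _ p])
    fix x y z assume F: "(x, y, z) \<in> F' lx ly (r\<^sup>2) (R\<^sup>2)"
    then have pos: "0 < x" "0 < y" using assms by (auto simp: F'_def)
    define t where "t = sqrt (x * y)"
    have t2: "t\<^sup>2 = z" using F pos by (auto simp: t_def F'_def)
    have "r\<^sup>2 \<le> t\<^sup>2" "t\<^sup>2 \<le> R\<^sup>2" "0 \<le> t" using F t2 pos by (auto simp: F'_def t_def)
    then have rt: "r \<le> t" "t \<le> R" using assms by (auto simp: power2_le_iff_abs_le)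
    have "2 * t \<le> s * x + y / s"
      using arith_geo_mean_sqrt[of "s * x" "y / s"] that pos by (simp add: t_def)
    then have "(r + R) * (2 * t) \<le> (r + R) * (s * x + y / s)"
      using assms by (intro mult_left_mono) auto
    \<comment> \<open>This replaces the concave \<open>(r + R) * sqrt z\<close> by its chord
      \<open>z + r * R\<close>, which makes the inequality affine.\<close>
    moreover have "0 \<le> (t - r) * (R - t)" using rt by simp
    ultimately show "2 * (r * R) \<le> ((r + R) * s) * x + ((r + R) / s) * y + (- 2) * z"
      unfolding t2[symmetric] by (simp add: algebra_simps power2_eq_square)
  qed
  have fam': "2 * (r * R) \<le> (r + R) * (s * x + y / s) - 2 * z" if "0 < s" for s
    using fam[OF that] by (simp add: algebra_simps)
  define s where "s = sqrt (y / x)"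
  have s: "0 < s" using assms by (simp add: s_def)
  have "s * x + y / s = 2 * sqrt (x * y)"
  proof -
    define X Y where "X = sqrt x" and "Y = sqrt y"
    have "0 < X" "0 < Y" "x = X * X" "y = Y * Y" "s = Y / X" "sqrt (x * y) = X * Y"
      using assms by (simp_all add: X_def Y_def s_def real_sqrt_divide real_sqrt_mult)
    then show ?thesis by simp
  qed
  then have "2 * (r * R) \<le> (r + R) * (2 * sqrt (x * y)) - 2 * z"
    using fam'[OF s] by simp
  then have "z + r * R \<le> (r + R) * sqrt (x * y)" by simp
  moreover have "0 \<le> z + r * R"
    using order_trans[OF zero_le_power2 hull_z_bounds(1)[OF p]] assms by simp
  ultimately have "(z + r * R)\<^sup>2 \<le> ((r + R) * sqrt (x * y))\<^sup>2" by (rule power_mono)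
  also have "\<dots> = (r + R)\<^sup>2 * (x * y)" using assms by (simp add: power_mult_distrib)
  finally show ?thesis .
qed

text \<open>If the minimizer \<open>k / A\<close> exceeds \<open>R\<close>, then \<open>B \<le> R\<^sup>2 A\<close> makes the value at \<open>R\<close> negative.\<close>
lemma quadratic_discriminant_interval:
  fixes A B k R :: real
  assumes quad: "\<And>s. 0 \<le> s \<Longrightarrow> s \<le> R \<Longrightarrow> 0 \<le> s\<^sup>2 * A - 2 * s * k + B"
    and "0 < R" "0 \<le> k" "B \<le> R\<^sup>2 * A"
  shows "k\<^sup>2 \<le> A * B"
proof -
  have B: "0 \<le> B" using quad[of 0] assms by simp
  then have "0 \<le> R\<^sup>2 * A" using assms by linarith
  then have A: "0 \<le> A" using assms by (simp add: zero_le_mult_iff)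
  show ?thesis
  proof (cases "A = 0")
    case True
    then have "B = 0" using B assms by simp
    then have "k = 0" using quad[of R] True assms by (simp add: zero_le_mult_iff mult_le_0_iff)
    then show ?thesis using True by simp
  next
    case False
    then have A: "0 < A" using A by simp
    show ?thesis
    proof (cases "k \<le> R * A")
      case True
      have "0 \<le> (k / A)\<^sup>2 * A - 2 * (k / A) * k + B"
        using True A assms by (intro quad) (auto simp: field_simps)
      also have "\<dots> = (A * B - k\<^sup>2) / A" using A by (simp add: field_simps power2_eq_square)
      finally show ?thesis using A by (simp add: zero_le_divide_iff)
    next
      case False
      then have "R * (R * A) < R * k" using assms by simp
      moreover have "0 \<le> R\<^sup>2 * A - 2 * (R * k) + B" using quad[of R] assms(2) by (simp add: mult.assoc)
      moreover have "R\<^sup>2 * A = R * (R * A)" by (simp add: power2_eq_square)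
      ultimately have False using \<open>B \<le> R\<^sup>2 * A\<close> by linarith
      then show ?thesis ..
    qed
  qed
qed

text \<open>For each \<open>s\<close> in \<open>[0, R]\<close> there is a plane through the apex
  \<open>(1, uz, uz)\<close>; for \<open>s > 0\<close> it touches the arc \<open>x * y = lz\<close>
  at \<open>(r / s, r * s)\<close>, and \<open>s \<le> R\<close> says that this contact point lies
  in the region. The slack is quadratic in \<open>s\<close>, and its discriminant yields the
  cone.\<close>

lemma hull_right_cone:
  assumes p: "(x, y, z) \<in> convex hull F' lx ly (r\<^sup>2) (R\<^sup>2)"
    and rR: "0 < r" "r < R" and l: "0 < lx" "0 < ly" and reg: "y \<le> R\<^sup>2 * x"
  shows "0 \<le> R\<^sup>2 * x + y - 2 * z"
    and "0 \<le> (R\<^sup>2 - z)\<^sup>2 - (R\<^sup>2 - z) * (R\<^sup>2 * (1 - x) + (R\<^sup>2 - y)) + (R\<^sup>2 - r\<^sup>2) * ((1 - x) * (R\<^sup>2 - y))"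
proof -
  have rR2: "r\<^sup>2 < R\<^sup>2" using rR by (simp add: power_strict_mono)
  have tangent: "(2 * s * r) * (R\<^sup>2 - r\<^sup>2) - (R\<^sup>2 + s\<^sup>2 - 2 * s * r) * r\<^sup>2
      \<le> (s\<^sup>2 * (R\<^sup>2 - r\<^sup>2)) * x + (R\<^sup>2 - r\<^sup>2) * y + (- (R\<^sup>2 + s\<^sup>2 - 2 * s * r)) * z"
    if s: "0 \<le> s" "s \<le> R" for s
  proof (rule affine_ineq_hull[OF _ p])
    fix x y z assume F: "(x, y, z) \<in> F' lx ly (r\<^sup>2) (R\<^sup>2)"
    then have x: "0 < x" "x \<le> 1" and z: "z = x * y" "r\<^sup>2 \<le> z" "z \<le> R\<^sup>2"
      using l by (auto simp: F'_def)
    have "s\<^sup>2 * x \<le> R\<^sup>2 * 1" using s x by (intro mult_mono power_mono) auto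
    \<comment> \<open>Certificate of validity: \<open>x\<close> times the slack is a sum of
      nonnegative terms, the second factor \<open>R\<^sup>2 - s\<^sup>2 * x\<close> being
      nonnegative because \<open>s \<le> R\<close> and \<open>x \<le> 1\<close>.\<close>
    then have "0 \<le> (z - r\<^sup>2) * (1 - x) * (R\<^sup>2 - s\<^sup>2 * x) + (R\<^sup>2 - z) * (s * x - r)\<^sup>2"
      using x z by simp
    also have "\<dots> = x * ((s\<^sup>2 * x + y - 2 * s * r) * (R\<^sup>2 - r\<^sup>2) - (R\<^sup>2 + s\<^sup>2 - 2 * s * r) * (z - r\<^sup>2))"
      unfolding z(1) by (simp add: algebra_simps power2_eq_square)
    finally have "0 \<le> (s\<^sup>2 * x + y - 2 * s * r) * (R\<^sup>2 - r\<^sup>2) - (R\<^sup>2 + s\<^sup>2 - 2 * s * r) * (z - r\<^sup>2)"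
      using x by (simp add: zero_le_mult_iff)
    then show "(2 * s * r) * (R\<^sup>2 - r\<^sup>2) - (R\<^sup>2 + s\<^sup>2 - 2 * s * r) * r\<^sup>2
      \<le> (s\<^sup>2 * (R\<^sup>2 - r\<^sup>2)) * x + (R\<^sup>2 - r\<^sup>2) * y + (- (R\<^sup>2 + s\<^sup>2 - 2 * s * r)) * z"
      by (simp add: algebra_simps)
  qed
  \<comment> \<open>As a polynomial in \<open>s\<close>, the tangent slack is
    \<open>s\<^sup>2 * A - 2 * s * (r * T) + B\<close>.\<close>
  define A B T where "A = (R\<^sup>2 - r\<^sup>2) * x - (z - r\<^sup>2)" and "B = (R\<^sup>2 - r\<^sup>2) * y - R\<^sup>2 * (z - r\<^sup>2)"
    and "T = R\<^sup>2 - z"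
  have "(r * T)\<^sup>2 \<le> A * B"
  proof (rule quadratic_discriminant_interval)
    show "0 \<le> s\<^sup>2 * A - 2 * s * (r * T) + B" if "0 \<le> s" "s \<le> R" for s
      using tangent[OF that] by (simp add: A_def B_def T_def algebra_simps)
    show "0 \<le> r * T" using rR hull_z_bounds[OF p] by (simp add: T_def)
    have "(R\<^sup>2 - r\<^sup>2) * y \<le> (R\<^sup>2 - r\<^sup>2) * (R\<^sup>2 * x)" using reg rR2 by (intro mult_left_mono) auto
    then show "B \<le> R\<^sup>2 * A" by (simp add: A_def B_def algebra_simps)
  qed (use rR in simp)
  also have "A * B = (r * T)\<^sup>2 + (R\<^sup>2 - r\<^sup>2) * ((R\<^sup>2 - z)\<^sup>2 - (R\<^sup>2 - z) * (R\<^sup>2 * (1 - x) + (R\<^sup>2 - y)) + (R\<^sup>2 - r\<^sup>2) * ((1 - x) * (R\<^sup>2 - y)))"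
    by (simp add: A_def B_def T_def algebra_simps power2_eq_square)
  finally show "0 \<le> (R\<^sup>2 - z)\<^sup>2 - (R\<^sup>2 - z) * (R\<^sup>2 * (1 - x) + (R\<^sup>2 - y)) + (R\<^sup>2 - r\<^sup>2) * ((1 - x) * (R\<^sup>2 - y))"
    using rR2 by (simp add: zero_le_mult_iff)
  have "0 \<le> R\<^sup>2 * x + 1 * y + (- 2) * z"
  proof (rule affine_ineq_hull[OF _ p])
    fix x y z assume F: "(x, y, z) \<in> F' lx ly (r\<^sup>2) (R\<^sup>2)"
    then have x: "0 < x" "x \<le> 1" and z: "z = x * y" "r\<^sup>2 \<le> z" "z \<le> R\<^sup>2"
      using l by (auto simp: F'_def)
    have "0 \<le> z * (1 - x)\<^sup>2 + (R\<^sup>2 - z) * x\<^sup>2"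
      using z order_trans[OF zero_le_power2 z(2)]
      by (intro add_nonneg_nonneg mult_nonneg_nonneg) simp_all
    also have "\<dots> = x * (R\<^sup>2 * x + 1 * y + (- 2) * z)"
      unfolding z(1) by (simp add: algebra_simps power2_eq_square)
    finally show "0 \<le> R\<^sup>2 * x + 1 * y + (- 2) * z"
      using x by (simp add: zero_le_mult_iff)
  qed
  then show "0 \<le> R\<^sup>2 * x + y - 2 * z" by simp
qed

section \<open>The quadratic forms and the square-root form of the constraints\<close>

lemma quad_form_M1: "quad_form (M1 lz uz) (vector [p, q]) = (uz * p + q)\<^sup>2 - 4 * (uz - lz) * (p * q)"
  by (simp add: quad_form_def M1_def inner_vec_def matrix_vector_mult_def sum_2
      algebra_simps power2_eq_square)

lemma quad_form_M2: "quad_form (M2 lz uz) (vector [p, q]) = (p + uz * q)\<^sup>2 - 4 * (uz - lz) * (p * q)"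
  by (simp add: quad_form_def M2_def inner_vec_def matrix_vector_mult_def sum_2
      algebra_simps power2_eq_square)

lemma square_sub_prod_nonneg:
  fixes lz uz p q :: real
  assumes "0 \<le> lz" "lz \<le> uz" "0 < uz"
  shows "0 \<le> (uz * p + q)\<^sup>2 - 4 * (uz - lz) * (p * q)"
proof -
  \<comment> \<open>After multiplication by \<open>uz\<close>, the form is a nonnegative combination
    of two squares.\<close>
  have "0 \<le> lz * (uz * p + q)\<^sup>2 + (uz - lz) * (uz * p - q)\<^sup>2" using assms by simp
  also have "\<dots> = uz * ((uz * p + q)\<^sup>2 - 4 * (uz - lz) * (p * q))"
    by (simp add: algebra_simps power2_eq_square)
  finally show ?thesis using assms by (simp add: zero_le_mult_iff)
qed

lemma psd_2I:
  fixes M :: "real^2^2"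
  assumes "transpose M = M" "\<And>p q. 0 \<le> quad_form M (vector [p, q])"
  shows "psd M"
  unfolding psd_def
proof (intro conjI allI)
  fix v :: "real^2"
  have "v = vector [v $ 1, v $ 2]" by (simp add: vec_eq_iff forall_2)
  then show "0 \<le> quad_form M v" using assms(2)[of "v $ 1" "v $ 2"] by simp
qed (rule assms(1))

lemma psd_M1:
  assumes "0 \<le> lz" "lz \<le> uz" "0 < uz"
  shows "psd (M1 lz uz)"
proof (rule psd_2I)
  show "transpose (M1 lz uz) = M1 lz uz"
    by (simp add: M1_def transpose_def vec_eq_iff forall_2)
  show "0 \<le> quad_form (M1 lz uz) (vector [p, q])" for p q
    unfolding quad_form_M1 by (rule square_sub_prod_nonneg[OF assms])
qed

lemma psd_M2:
  assumes "0 \<le> lz" "lz \<le> uz" "0 < uz"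
  shows "psd (M2 lz uz)"
proof (rule psd_2I)
  show "transpose (M2 lz uz) = M2 lz uz"
    by (simp add: M2_def transpose_def vec_eq_iff forall_2)
  show "0 \<le> quad_form (M2 lz uz) (vector [p, q])" for p q
    using square_sub_prod_nonneg[OF assms, of q p]
    unfolding quad_form_M2 by (simp add: add.commute mult.commute)
qed

text \<open>Squaring is legitimate once the right side is nonnegative, and the square of the right
  side exceeds the radicand by four times the polynomial used in the geometric lemmas.\<close>

lemma sqrt_cone_iff:
  fixes lz uz x y z :: real
  assumes "0 \<le> lz" "lz \<le> uz" "0 < uz"
  shows "sqrt ((uz * (1 - x) + (uz - y))\<^sup>2 - 4 * (uz - lz) * ((1 - x) * (uz - y))) \<le> uz * x + y - 2 * z \<longleftrightarrow>
    0 \<le> uz * x + y - 2 * z \<and>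
    0 \<le> (uz - z)\<^sup>2 - (uz - z) * (uz * (1 - x) + (uz - y)) + (uz - lz) * ((1 - x) * (uz - y))"
    (is "sqrt ?q \<le> ?l \<longleftrightarrow> 0 \<le> ?l \<and> 0 \<le> ?c")
proof -
  have "?l\<^sup>2 - ?q = 4 * ?c" by (simp add: algebra_simps power2_eq_square)
  moreover have "sqrt ?q \<le> ?l \<longleftrightarrow> 0 \<le> ?l \<and> ?q \<le> ?l\<^sup>2"
  proof
    assume *: "sqrt ?q \<le> ?l"
    have "0 \<le> sqrt ?q" using square_sub_prod_nonneg[OF assms, of "1 - x" "uz - y"] by simp
    then show "0 \<le> ?l \<and> ?q \<le> ?l\<^sup>2" using * sqrt_le_D[OF *] by linarith
  next
    assume "0 \<le> ?l \<and> ?q \<le> ?l\<^sup>2"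
    then show "sqrt ?q \<le> ?l" by (intro real_le_lsqrt) auto
  qed
  ultimately show ?thesis by auto
qed

section \<open>The two inclusions, assembled region by region\<close>

theorem proposition7:
  fixes lx ly lz uz :: real
  assumes "0 < lz" and "lz < uz" and "uz < 1"
    and "lz \<le> lx" and "lx \<le> uz"
    and "lz \<le> ly" and "ly \<le> uz"
    and "lx * ly < lz"
    and "(lx, ly) \<in> region_B lz uz"
  shows "psd (M1 lz uz) \<and> psd (M2 lz uz) \<and>
    convex hull (F' lx ly lz uz) =
      {(x, y, z). RLT lx ly x y z \<and> lz \<le> z \<and> z \<le> uz \<and>
         (y \<ge> uz * x \<and> x \<ge> uz * y \<longrightarrow>
            (z + sqrt (lz * uz))\<^sup>2 \<le> (sqrt lz + sqrt uz)\<^sup>2 * (x * y)) \<and>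
         (y \<le> uz * x \<longrightarrow>
            sqrt (quad_form (M1 lz uz) (vector [1 - x, uz - y])) \<le> uz * x + y - 2 * z) \<and>
         (x \<le> uz * y \<longrightarrow>
            sqrt (quad_form (M2 lz uz) (vector [uz - x, 1 - y])) \<le> x + uz * y - 2 * z)}"
    (is "_ \<and> _ \<and> ?H = ?S")
proof -
  define r R where "r = sqrt lz" and "R = sqrt uz"
  have sq: "r\<^sup>2 = lz" "R\<^sup>2 = uz" using assms by (simp_all add: r_def R_def)
  have rR: "sqrt (lz * uz) = r * R" by (simp add: r_def R_def real_sqrt_mult)
  interpret cut_box lx ly r R ?H
  proof
    fix x y assume "lx \<le> x" "x \<le> 1" "ly \<le> y" "y \<le> 1" "r\<^sup>2 \<le> x * y" "x * y \<le> R\<^sup>2"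
    then have "(x, y, x * y) \<in> F' lx ly lz uz" by (auto simp: F'_def sq)
    then show "(x, y, x * y) \<in> ?H" by (rule hull_inc)
  qed (use assms in \<open>auto simp: sq rR region_B_def convex_convex_hull\<close>,
      use assms in \<open>auto simp: r_def R_def\<close>)
  interpret swapped: cut_box ly lx r R "{(x, y, z). (y, x, z) \<in> ?H}" by (rule swap)
  have lu: "0 \<le> lz" "lz \<le> uz" "0 < uz" using assms by auto
  have q1: "sqrt (quad_form (M1 lz uz) (vector [1 - x, uz - y])) \<le> uz * x + y - 2 * z \<longleftrightarrow>
      0 \<le> R\<^sup>2 * x + y - 2 * z \<and>
      0 \<le> (R\<^sup>2 - z)\<^sup>2 - (R\<^sup>2 - z) * (R\<^sup>2 * (1 - x) + (R\<^sup>2 - y)) + (R\<^sup>2 - r\<^sup>2) * ((1 - x) * (R\<^sup>2 - y))"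
    for x y z unfolding quad_form_M1 sq by (rule sqrt_cone_iff[OF lu])
  \<comment> \<open>The third constraint is the second with \<open>x\<close> and \<open>y\<close>
    exchanged, so the swapped instance handles it.\<close>
  have q2: "sqrt (quad_form (M2 lz uz) (vector [uz - x, 1 - y])) \<le> x + uz * y - 2 * z \<longleftrightarrow>
      sqrt (quad_form (M1 lz uz) (vector [1 - y, uz - x])) \<le> uz * y + x - 2 * z" for x y z
    unfolding quad_form_M1 quad_form_M2 by (simp add: add.commute mult.commute)
  have "?H \<subseteq> ?S"
  proof (rule subsetI, clarify)
    fix x y z assume p: "(x, y, z) \<in> ?H"
    then have p': "(x, y, z) \<in> convex hull F' lx ly (r\<^sup>2) (R\<^sup>2)"
      and p'': "(y, x, z) \<in> convex hull F' ly lx (r\<^sup>2) (R\<^sup>2)"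
      by (simp_all add: sq F'_swap_hull)
    have rlt: "RLT lx ly x y z" by (rule hull_RLT[OF p])
    have "lx \<le> x" "ly \<le> y" using RLT_imp_ge[OF rlt] a_less_1 b_less_1 by auto
    then have "0 < x" "0 < y" using a_pos b_pos by auto
    show "RLT lx ly x y z \<and> lz \<le> z \<and> z \<le> uz \<and>
         (y \<ge> uz * x \<and> x \<ge> uz * y \<longrightarrow>
            (z + sqrt (lz * uz))\<^sup>2 \<le> (sqrt lz + sqrt uz)\<^sup>2 * (x * y)) \<and>
         (y \<le> uz * x \<longrightarrow>
            sqrt (quad_form (M1 lz uz) (vector [1 - x, uz - y])) \<le> uz * x + y - 2 * z) \<and>
         (x \<le> uz * y \<longrightarrow>
            sqrt (quad_form (M2 lz uz) (vector [uz - x, 1 - y])) \<le> x + uz * y - 2 * z)"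
      unfolding q2 q1
      using rlt hull_z_bounds[OF p]
        hull_middle_cone[OF p' r_pos r_less a_pos b_pos \<open>0 < x\<close> \<open>0 < y\<close>]
        hull_right_cone[OF p' r_pos r_less a_pos b_pos]
        hull_right_cone[OF p'' r_pos r_less b_pos a_pos]
      by (auto simp: rR sq r_def[symmetric] R_def[symmetric])
  qed
  moreover have "?S \<subseteq> ?H"
  proof (rule subsetI, clarify)
    fix x y z
    assume rlt: "RLT lx ly x y z" and z: "lz \<le> z" "z \<le> uz"
      and mid: "y \<ge> uz * x \<and> x \<ge> uz * y \<longrightarrow>
            (z + sqrt (lz * uz))\<^sup>2 \<le> (sqrt lz + sqrt uz)\<^sup>2 * (x * y)"
      and right: "y \<le> uz * x \<longrightarrow>
            sqrt (quad_form (M1 lz uz) (vector [1 - x, uz - y])) \<le> uz * x + y - 2 * z"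
      and top: "x \<le> uz * y \<longrightarrow>
            sqrt (quad_form (M2 lz uz) (vector [uz - x, 1 - y])) \<le> x + uz * y - 2 * z"
    have "lx \<le> x" "ly \<le> y" using RLT_imp_ge[OF rlt] a_less_1 b_less_1 by auto
    then have "0 < x" "0 < y" using a_pos b_pos by auto
    note rlt' = rlt[unfolded RLT_def]
    consider "y \<le> uz * x" | "x \<le> uz * y" | "uz * x \<le> y" "uz * y \<le> x" by linarith
    then show "(x, y, z) \<in> ?H"
    proof cases
      case 1
      then show ?thesis using right rlt' z unfolding q1 by (intro right_region) (auto simp: sq)
    next
      case 2
      have "(y, x, z) \<in> {(x, y, z). (y, x, z) \<in> ?H}"
        using 2 top rlt' z unfolding q2 q1
        by (intro swapped.right_region) (auto simp: sq algebra_simps)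
      then show ?thesis by simp
    next
      case 3
      then show ?thesis using mid rlt' z \<open>0 < x\<close> \<open>0 < y\<close>
        by (intro middle_region) (auto simp: sq rR r_def[symmetric] R_def[symmetric])
    qed
  qed
  ultimately show ?thesis using psd_M1[OF lu] psd_M2[OF lu] by auto
qed

end
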